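(* Let $X,\nu,R,M_p,M_p^*$ be as in the context, with $R\nabla$ closable in $L^p(X,\nu)$ for every $p\in(1,\infty)$, and let $g:X\to\mathbb{R}$ be a Borel function such that, for every $p>1$, $g\in W^{1,p}(X,\nu)$ and $Mg\,\|Mg\|^{-2}\in D(M_p^* )$. Let $B\subset X$ be a Borel set with $C_p(B)=0$ for some $p>1$. Then $\sigma_r^g(B)=0$ for every $r\in\mathbb{R}$.
   Context: $X$ is a separable infinite-dimensional real Hilbert space with inner product $\langle\cdot,\cdot\rangle$ and norm $\|\cdot\|$, and $\nu$ is a non-degenerate Borel probability measure on $X$ (non-degenerate: not concentrated on any proper closed linear subspace). $C_b(X)$ is the space of bounded continuous real functions; $C_b^1(X)$ is the space of bounded continuously Fréchet differentiable $\varphi:X\to\mathbb{R}$ with bounded gradient $\nabla\varphi$. $R\in\mathcal{L}(X)$ is a bounded linear operator such that for every $p\in(1,\infty)$ the operator $\varphi\mapsto R\nabla\varphi$, with domain $C^1_b(X)\subset L^p(X,\nu)$ and values in $L^p(X,\nu;X)$, is closable. $M_p$ denotes its closure, $W^{1,p}(X,\nu)$ the domain of $M_p$, with norm $\|f\|_{W^{1,p}}=\|f\|_{L^p(X,\nu)}+\|M_pf\|_{L^p(X,\nu;X)}$. With $p'=p/(p-1)$, $M_p^*:D(M_p^* )\subset L^{p'}(X,\nu;X)\to L^{p'}(X,\nu)$ is the adjoint of $M_p$. One writes $M$, $M^*$ on $\bigcap_{p>1}W^{1,p}(X,\nu)$, $\bigcap_{p>1}D(M_p^* )$, where the operators do not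 depend on $p$. The condition on $Mg\,\|Mg\|^{-2}$ includes that it is defined $\nu$-a.e. For $r\in\mathbb{R}$, $\sigma_r^g$ is the unique finite nonnegative Borel measure on $X$ such that $\int_X\varphi\,d\sigma_r^g=\frac{d}{dr}\int_{\{g\le r\}}\varphi\,d\nu$ for every $\varphi\in C_b(X)$ (the derivatives and the measure exist whenever $R\nabla$ is closable in $L^p(X,\nu)$ for every $p\in(1,\infty)$ and $g:X\to\mathbb{R}$ is a Borel function such that $g\in W^{1,p}(X,\nu)$ and $Mg\,\|Mg\|^{-2}\in D(M_p^* )$ for every $p>1$). Capacity: for $O\subset X$ open, $C_p(O)=\inf\{\|f\|_{W^{1,p}(X,\nu)}: f\in W^{1,p}(X,\nu),\ f\ge \mathbf{1}_O\ \nu\text{-a.e.}\}$; for a Borel set $B$, $C_p(B)=\inf\{C_p(O): O\text{ open},\ O\supset B\}$. *)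

theory Defs
  imports "HOL-Probability.Probability"
begin

text \<open>
  Elements of \<open>L\<^sup>p\<close> spaces are represented by Borel functions. Identification up to
  \<open>\<nu>\<close>-null sets is expressed with \<open>AE\<close>; the notions
  concerning elements of \<open>L\<^sup>p\<close> are invariant under Borel changes on \<open>\<nu>\<close>-null sets.
\<close>

definition nondegenerate :: "'a::real_normed_vector measure \<Rightarrow> bool" where
  "nondegenerate \<nu> \<longleftrightarrow> (\<forall>S. subspace S \<and> closed S \<and> S \<noteq> UNIV \<longrightarrow> \<not> (AE x in \<nu>. x \<in> S))"

definition lp_fun :: "'a measure \<Rightarrow> real \<Rightarrow> ('a \<Rightarrow> 'b::real_normed_vector) set" where
  "lp_fun \<nu> p = {f \<in> borel_measurable \<nu>. integrable \<nu> (\<lambda>x. norm (f x) powr p)}"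

definition lp_norm :: "'a measure \<Rightarrow> real \<Rightarrow> ('a \<Rightarrow> 'b::real_normed_vector) \<Rightarrow> real" where
  "lp_norm \<nu> p f = (LINT x|\<nu>. norm (f x) powr p) powr (1 / p)"

definition Cb :: "('a::topological_space \<Rightarrow> real) set" where
  "Cb = {\<phi>. continuous_on UNIV \<phi> \<and> bounded (range \<phi>)}"

text \<open>
  For \<open>\<phi>\<close> differentiable at \<open>x\<close> in a Hilbert space, the Riesz representative of the
  derivative exists and is unique; continuity of the derivative in operator norm is
  continuity of \<open>grad \<phi>\<close>, since the Riesz map is an isometry.
\<close>

definition grad :: "('a::real_inner \<Rightarrow> real) \<Rightarrow> 'a \<Rightarrow> 'a" where
  "grad \<phi> x = (THE v. GDERIV \<phi> x :> v)"

definition C1b :: "('a::real_inner \<Rightarrow> real) set" where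
  "C1b = {\<phi>. bounded (range \<phi>) \<and> (\<forall>x. \<phi> differentiable (at x)) \<and>
             continuous_on UNIV (grad \<phi>) \<and> bounded (range (grad \<phi>))}"

text \<open>
  \<open>M_graph \<nu> R p f F\<close>: the pair \<open>(f, F)\<close> lies in the closure, in
  \<open>L\<^sup>p(X,\<nu>) \<times> L\<^sup>p(X,\<nu>;X)\<close>, of the graph of \<open>\<phi> \<mapsto> R\<nabla>\<phi>\<close> on \<open>C1b\<close>.
\<close>

definition M_graph ::
  "'a::real_inner measure \<Rightarrow> ('a \<Rightarrow> 'a) \<Rightarrow> real \<Rightarrow> ('a \<Rightarrow> real) \<Rightarrow> ('a \<Rightarrow> 'a) \<Rightarrow> bool" where
  "M_graph \<nu> R p f F \<longleftrightarrow> f \<in> lp_fun \<nu> p \<and> F \<in> lp_fun \<nu> p \<and>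
     (\<exists>\<phi>::nat \<Rightarrow> 'a \<Rightarrow> real. (\<forall>n. \<phi> n \<in> C1b) \<and>
        (\<lambda>n. lp_norm \<nu> p (\<lambda>x. \<phi> n x - f x)) \<longlonglongrightarrow> 0 \<and>
        (\<lambda>n. lp_norm \<nu> p (\<lambda>x. R (grad (\<phi> n) x) - F x)) \<longlonglongrightarrow> 0)"

text \<open>
  Applied to constant sequences, closability includes that \<open>R\<nabla>\<phi>\<close> depends only on
  the \<open>\<nu>\<close>-equivalence class of \<open>\<phi>\<close>.
\<close>

definition closable_R_grad :: "'a::real_inner measure \<Rightarrow> ('a \<Rightarrow> 'a) \<Rightarrow> real \<Rightarrow> bool" where
  "closable_R_grad \<nu> R p \<longleftrightarrow> (\<forall>F. M_graph \<nu> R p (\<lambda>_. 0) F \<longrightarrow> (AE x in \<nu>. F x = 0))"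

definition W1p :: "'a::real_inner measure \<Rightarrow> ('a \<Rightarrow> 'a) \<Rightarrow> real \<Rightarrow> ('a \<Rightarrow> real) set" where
  "W1p \<nu> R p = {f. \<exists>F. M_graph \<nu> R p f F}"

text \<open>Under closability the chosen representative is unique up to \<open>\<nu>\<close>-null sets.\<close>

definition M_op ::
  "'a::real_inner measure \<Rightarrow> ('a \<Rightarrow> 'a) \<Rightarrow> real \<Rightarrow> ('a \<Rightarrow> real) \<Rightarrow> 'a \<Rightarrow> 'a" where
  "M_op \<nu> R p f = (SOME F. M_graph \<nu> R p f F)"

definition W1p_norm ::
  "'a::real_inner measure \<Rightarrow> ('a \<Rightarrow> 'a) \<Rightarrow> real \<Rightarrow> ('a \<Rightarrow> real) \<Rightarrow> real" where
  "W1p_norm \<nu> R p f = lp_norm \<nu> p f + lp_norm \<nu> p (M_op \<nu> R p f)"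

text \<open>
  The adjoint of \<open>M_op \<nu> R p\<close>, as a relation between \<open>\<Psi> \<in> L\<^sup>p\<^sup>'(X,\<nu>;X)\<close> and
  \<open>h \<in> L\<^sup>p\<^sup>'(X,\<nu>)\<close>, where \<open>p' = p / (p - 1)\<close>.
\<close>

definition M_adj_graph ::
  "'a::real_inner measure \<Rightarrow> ('a \<Rightarrow> 'a) \<Rightarrow> real \<Rightarrow> ('a \<Rightarrow> 'a) \<Rightarrow> ('a \<Rightarrow> real) \<Rightarrow> bool" where
  "M_adj_graph \<nu> R p \<Psi> h \<longleftrightarrow> \<Psi> \<in> lp_fun \<nu> (p / (p - 1)) \<and> h \<in> lp_fun \<nu> (p / (p - 1)) \<and>
     (\<forall>f \<in> W1p \<nu> R p. (LINT x|\<nu>. M_op \<nu> R p f x \<bullet> \<Psi> x) = (LINT x|\<nu>. f x * h x))"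

definition M_adj_dom ::
  "'a::real_inner measure \<Rightarrow> ('a \<Rightarrow> 'a) \<Rightarrow> real \<Rightarrow> ('a \<Rightarrow> 'a) set" where
  "M_adj_dom \<nu> R p = {\<Psi>. \<exists>h. M_adj_graph \<nu> R p \<Psi> h}"

text \<open>
  The defining property of the measure \<open>\<sigma>\<^sub>r\<^sup>g\<close>. A finite Borel measure on a metric space
  is determined by its integrals of \<open>Cb\<close> functions, so at most one \<open>\<sigma>\<close> has it.
\<close>

definition is_level_measure ::
  "'a::topological_space measure \<Rightarrow> ('a \<Rightarrow> real) \<Rightarrow> real \<Rightarrow> 'a measure \<Rightarrow> bool" where
  "is_level_measure \<nu> g r \<sigma> \<longleftrightarrow> sets \<sigma> = sets borel \<and> finite_measure \<sigma> \<and>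
     (\<forall>\<phi> \<in> Cb. ((\<lambda>s. LINT x:{x. g x \<le> s}|\<nu>. \<phi> x) has_real_derivative (LINT x|\<sigma>. \<phi> x)) (at r))"

text \<open>
  Both infima are over nonempty sets of nonnegative reals when \<open>\<nu>\<close> is a probability
  measure and \<open>p > 1\<close>: constant functions belong to \<open>W1p\<close>, and \<open>UNIV\<close> is open.
\<close>

definition capacity_open ::
  "'a::real_inner measure \<Rightarrow> ('a \<Rightarrow> 'a) \<Rightarrow> real \<Rightarrow> 'a set \<Rightarrow> real" where
  "capacity_open \<nu> R p U =
     Inf {W1p_norm \<nu> R p f |f. f \<in> W1p \<nu> R p \<and> (AE x in \<nu>. indicator U x \<le> f x)}"

definition capacity ::
  "'a::real_inner measure \<Rightarrow> ('a \<Rightarrow> 'a) \<Rightarrow> real \<Rightarrow> 'a set \<Rightarrow> real" where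
  "capacity \<nu> R p B = Inf {capacity_open \<nu> R p U |U. open U \<and> B \<subseteq> U}"

end

theory Submission
  imports Defs
begin

text \<open>
  Integrating by parts along a vector field that is transversal to the level sets of \<open>g\<close> bounds
  \<open>\<sigma>\<^sub>r\<^sup>g\<close> by a multiple of the capacity. Fix \<open>p\<close> with \<open>C\<^sub>p(B) = 0\<close> and put
  \<open>\<Psi> = Mg / \<parallel>Mg\<parallel>\<^sup>2\<close> and \<open>h = M\<^sub>p\<^sup>* \<Psi>\<close>. Since \<open>\<langle>Mg, \<Psi>\<rangle> = 1\<close>, applying the definition of the
  adjoint to the product \<open>f \<theta>(g)\<close>, for which \<open>M(f \<theta>(g)) = \<theta>(g) Mf + f \<theta>'(g) Mg\<close>, gives
  \<open>\<integral> f \<theta>'(g) d\<nu> = \<integral> \<theta>(g) (f h - \<langle>Mf, \<Psi>\<rangle>) d\<nu>\<close>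
  (\<open>integration_by_parts\<close>). By Hoelder the right side is at most
  \<open>sup |\<theta>| (\<parallel>h\<parallel> + \<parallel>\<Psi>\<parallel>) \<parallel>f\<parallel>\<close>, with the norms of \<open>L\<^sup>p\<^sup>'\<close> and \<open>W\<^sup>1\<^sup>,\<^sup>p\<close>. The point is that
  \<open>\<theta>'\<close> does not occur in this bound.

  Taking \<open>\<theta>(s) = arctan ((s - r) / e)\<close>, \<open>|\<theta>| \<le> \<pi>/2\<close> for every \<open>e > 0\<close>, while
  \<open>2 \<theta>'\<close> dominates \<open>1/e\<close> times the indicator of \<open>(r, r + e]\<close>. Hence if \<open>f \<ge> \<phi> \<ge> 0\<close> with \<open>\<phi>\<close> continuous
  and bounded, the quotients \<open>1/e \<integral>\<^bsub>{r < g \<le> r + e}\<^esub> \<phi> d\<nu>\<close> are bounded by \<open>C \<parallel>f\<parallel>\<close> with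
  \<open>C = \<pi> (\<parallel>h\<parallel> + \<parallel>\<Psi>\<parallel>)\<close>, and so is their limit \<open>\<integral> \<phi> d\<sigma>\<^sub>r\<^sup>g\<close> (\<open>level_measure_Cb_bound\<close>).
  If \<open>U\<close> is open and \<open>f \<ge> 1\<^sub>U\<close>, letting such \<open>\<phi> \<le> 1\<^sub>U\<close> tend to \<open>1\<^sub>U\<close> gives \<open>\<sigma>\<^sub>r\<^sup>g(U) \<le> C \<parallel>f\<parallel>\<close>, and the
  infimum over \<open>f\<close> and \<open>U\<close> gives \<open>\<sigma>\<^sub>r\<^sup>g(B) \<le> C C\<^sub>p(B)\<close>
  (\<open>level_measure_le_capacity\<close>).

  The product rule is used only for functions in \<open>C1b\<close>: both \<open>f\<close> and \<open>g\<close> are replaced by their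
  approximations, for which the identity is exact, and the limits are taken in the integrals.
\<close>

section \<open>Lebesgue spaces and the Hoelder inequality\<close>

lemma lp_norm_nonneg: "0 \<le> lp_norm M p f"
  by (simp add: lp_norm_def)

lemma lp_fun_dominated:
  assumes "0 < p" "g \<in> lp_fun M p" "f \<in> borel_measurable M"
    and le: "\<And>x. norm (f x) \<le> K * norm (g x)"
  shows "f \<in> lp_fun M p"
proof -
  have "integrable M (\<lambda>x. \<bar>K\<bar> powr p * norm (g x) powr p)"
    using assms by (simp add: lp_fun_def)
  then have "integrable M (\<lambda>x. norm (f x) powr p)"
  proof (rule Bochner_Integration.integrable_bound)
    show "(\<lambda>x. norm (f x) powr p) \<in> borel_measurable M"
      using assms(3) by measurable
    show "AE x in M. norm (norm (f x) powr p) \<le> norm (\<bar>K\<bar> powr p * norm (g x) powr p)"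
    proof (intro AE_I2)
      fix x
      have "norm (f x) \<le> \<bar>K\<bar> * norm (g x)"
        by (rule order_trans[OF le]) (simp add: mult_right_mono)
      then have "norm (f x) powr p \<le> (\<bar>K\<bar> * norm (g x)) powr p"
        using \<open>0 < p\<close> by (intro powr_mono2) auto
      then show "norm (norm (f x) powr p) \<le> norm (\<bar>K\<bar> powr p * norm (g x) powr p)"
        by (simp add: powr_mult)
    qed
  qed
  then show ?thesis
    using assms(3) by (simp add: lp_fun_def)
qed

lemma lp_fun_bounded:
  fixes f :: "'a \<Rightarrow> 'b::real_normed_vector"
  assumes "finite_measure M" "0 < p" "f \<in> borel_measurable M" "bounded (range f)"
  shows "f \<in> lp_fun M p"
proof -
  interpret finite_measure M by fact
  obtain K where K: "\<And>x. norm (f x) \<le> K"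
    using assms(4) by (auto simp: bounded_iff)
  have one: "(\<lambda>_. 1::real) \<in> lp_fun M p"
    by (simp add: lp_fun_def)
  show ?thesis
    by (rule lp_fun_dominated[OF assms(2) one assms(3), where K=K]) (simp add: K)
qed

lemma lp_fun_diff:
  fixes f g :: "'a \<Rightarrow> 'b::{real_normed_vector, second_countable_topology}"
  assumes "0 < p" "f \<in> lp_fun M p" "g \<in> lp_fun M p"
  shows "(\<lambda>x. f x - g x) \<in> lp_fun M p"
proof (rule lp_fun_dominated[where K=2 and g="\<lambda>x. max (norm (f x)) (norm (g x))"])
  have [measurable]: "f \<in> borel_measurable M" "g \<in> borel_measurable M"
    using assms by (simp_all add: lp_fun_def)
  have "integrable M (\<lambda>x. norm (f x) powr p + norm (g x) powr p)"
    using assms by (simp add: lp_fun_def)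
  then have "integrable M (\<lambda>x. norm (max (norm (f x)) (norm (g x))) powr p)"
    by (rule Bochner_Integration.integrable_bound) (measurable, auto simp: max_def)
  then show "(\<lambda>x. max (norm (f x)) (norm (g x))) \<in> lp_fun M p"
    by (simp add: lp_fun_def)
  show "(\<lambda>x. f x - g x) \<in> borel_measurable M"
    by measurable
  show "norm (f x - g x) \<le> 2 * norm (max (norm (f x)) (norm (g x)))" for x
    using norm_triangle_ineq4[of "f x" "g x"] by (auto simp: max_def)
qed fact

lemma Holder_norm:
  fixes f :: "'a \<Rightarrow> 'b::real_normed_vector" and g :: "'a \<Rightarrow> 'c::real_normed_vector"
  assumes "1 < p" and f: "f \<in> lp_fun M p" and g: "g \<in> lp_fun M (p / (p - 1))"
  shows "integrable M (\<lambda>x. norm (f x) * norm (g x))" (is ?int)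
    and "(LINT x|M. norm (f x) * norm (g x)) \<le> lp_norm M p f * lp_norm M (p / (p - 1)) g" (is ?le)
proof -
  define q where "q = p / (p - 1)"
  have q: "1 < q" "1 / p + 1 / q = 1"
    using \<open>1 < p\<close> by (auto simp: q_def field_simps)
  have int: "integrable M (\<lambda>x. norm (f x) powr p)" "integrable M (\<lambda>x. norm (g x) powr q)"
    and [measurable]: "f \<in> borel_measurable M" "g \<in> borel_measurable M"
    using f g by (simp_all add: lp_fun_def q_def)
  have young: "norm (f x) * norm (g x) \<le> norm (f x) powr p / p + norm (g x) powr q / q" for x
    using q \<open>1 < p\<close> by (intro Youngs_inequality) auto
  show ?int
  proof (rule Bochner_Integration.integrable_bound)
    show "integrable M (\<lambda>x. norm (f x) powr p / p + norm (g x) powr q / q)"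
      using int by simp
    show "AE x in M. norm (norm (f x) * norm (g x)) \<le> norm (norm (f x) powr p / p + norm (g x) powr q / q)"
      using young by (auto intro!: AE_I2 order_trans[OF young])
  qed measurable
  note [simp] = this
  let ?A = "lp_norm M p f" and ?B = "lp_norm M q g"
  \<comment> \<open>Normalising by constants above the norms, instead of the norms, avoids the case of a
    vanishing norm.\<close>
  have bound: "(LINT x|M. norm (f x) * norm (g x)) \<le> a * b" if "?A < a" "?B < b" for a b
  proof -
    have a: "0 < a" and b: "0 < b"
      using that lp_norm_nonneg[of M p f] lp_norm_nonneg[of M q g] by linarith+
    have "(LINT x|M. norm (f x) powr p) = ?A powr p"
      using \<open>1 < p\<close> by (simp add: lp_norm_def powr_powr)
    also have "\<dots> \<le> a powr p"
      using that \<open>1 < p\<close> by (intro powr_mono2) (auto simp: lp_norm_nonneg)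
    finally have A: "(LINT x|M. norm (f x) powr p) / a powr p \<le> 1"
      using a by (simp add: field_simps)
    have "(LINT x|M. norm (g x) powr q) = ?B powr q"
      using q by (simp add: lp_norm_def powr_powr)
    also have "\<dots> \<le> b powr q"
      using that q by (intro powr_mono2) (auto simp: lp_norm_nonneg)
    finally have B: "(LINT x|M. norm (g x) powr q) / b powr q \<le> 1"
      using b by (simp add: field_simps)
    have "(LINT x|M. norm (f x) * norm (g x)) / (a * b) = (LINT x|M. norm (f x) * norm (g x) / (a * b))"
      by simp
    also have "\<dots> \<le> (LINT x|M. (norm (f x) powr p / a powr p) / p + (norm (g x) powr q / b powr q) / q)"
    proof (rule integral_mono)
      fix x
      have "(norm (f x) / a) * (norm (g x) / b) \<le> (norm (f x) / a) powr p / p + (norm (g x) / b) powr q / q"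
        using q \<open>1 < p\<close> a b by (intro Youngs_inequality) auto
      then show "norm (f x) * norm (g x) / (a * b) \<le> (norm (f x) powr p / a powr p) / p + (norm (g x) powr q / b powr q) / q"
        using a b by (simp add: powr_divide)
    qed (use int in simp_all)
    also have "\<dots> = ((LINT x|M. norm (f x) powr p) / a powr p) / p + ((LINT x|M. norm (g x) powr q) / b powr q) / q"
      using int by simp
    also have "\<dots> \<le> 1 / p + 1 / q"
      using A B q \<open>1 < p\<close> by (intro add_mono divide_right_mono) auto
    finally show ?thesis
      using q a b by (simp add: field_simps)
  qed
  have "(\<lambda>n. (?A + inverse (real (Suc n))) * (?B + inverse (real (Suc n)))) \<longlonglongrightarrow> (?A + 0) * (?B + 0)"
    by (intro tendsto_intros LIMSEQ_inverse_real_of_nat)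
  then have "(LINT x|M. norm (f x) * norm (g x)) \<le> (?A + 0) * (?B + 0)"
    by (rule LIMSEQ_le_const) (auto intro!: bound)
  then show ?le
    by (simp add: q_def)
qed

text \<open>
  The form in which the Hoelder inequality is applied below: the bounded weight \<open>w\<close> will be \<open>\<theta>(g)\<close>,
  \<open>\<theta>'(g)\<close> or \<open>f \<theta>'(u)\<close>, and scalar factors are covered because the inner product of
  reals is multiplication.
\<close>

lemma Holder_weighted_inner:
  fixes f g :: "'a \<Rightarrow> 'b::{real_inner, second_countable_topology}"
  assumes "1 < p" and f: "f \<in> lp_fun M p" and g: "g \<in> lp_fun M (p / (p - 1))"
    and w: "w \<in> borel_measurable M" "\<And>x. \<bar>w x\<bar> \<le> K"
  shows "integrable M (\<lambda>x. w x * (f x \<bullet> g x))" (is ?int)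
    and "\<bar>LINT x|M. w x * (f x \<bullet> g x)\<bar> \<le> K * (lp_norm M p f * lp_norm M (p / (p - 1)) g)" (is ?le)
proof -
  have [measurable]: "f \<in> borel_measurable M" "g \<in> borel_measurable M" "w \<in> borel_measurable M"
    using f g w by (simp_all add: lp_fun_def)
  have K: "0 \<le> K"
    using w(2)[of undefined] by linarith
  have int: "integrable M (\<lambda>x. K * (norm (f x) * norm (g x)))"
    using Holder_norm(1)[OF \<open>1 < p\<close> f g] by simp
  have le: "\<bar>w x * (f x \<bullet> g x)\<bar> \<le> K * (norm (f x) * norm (g x))" for x
    unfolding abs_mult by (intro mult_mono w Cauchy_Schwarz_ineq2 K) simp
  show ?int
  proof (rule Bochner_Integration.integrable_bound[OF int])
    show "AE x in M. norm (w x * (f x \<bullet> g x)) \<le> norm (K * (norm (f x) * norm (g x)))"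
      by (auto intro!: AE_I2 order_trans[OF le])
  qed measurable
  then have "(LINT x|M. \<bar>w x * (f x \<bullet> g x)\<bar>) \<le> (LINT x|M. K * (norm (f x) * norm (g x)))"
    using int le by (intro integral_mono) auto
  then have "\<bar>LINT x|M. w x * (f x \<bullet> g x)\<bar> \<le> (LINT x|M. K * (norm (f x) * norm (g x)))"
    by (rule order_trans[OF integral_abs_bound])
  also have "\<dots> \<le> K * (lp_norm M p f * lp_norm M (p / (p - 1)) g)"
    using Holder_norm(2)[OF \<open>1 < p\<close> f g] K by (simp add: mult_left_mono)
  finally show ?le .
qed

lemma tendsto_weighted_inner:
  fixes f g :: "'a \<Rightarrow> 'b::{real_inner, second_countable_topology}"
  assumes "1 < p" and f: "f \<in> lp_fun M p" "\<And>n. F n \<in> lp_fun M p"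
    and g: "g \<in> lp_fun M (p / (p - 1))"
    and w: "w \<in> borel_measurable M" "\<And>x. \<bar>w x\<bar> \<le> K"
    and lim: "(\<lambda>n. lp_norm M p (\<lambda>x. F n x - f x)) \<longlonglongrightarrow> 0"
  shows "(\<lambda>n. LINT x|M. w x * (F n x \<bullet> g x)) \<longlonglongrightarrow> (LINT x|M. w x * (f x \<bullet> g x))"
proof -
  have d: "(\<lambda>x. F n x - f x) \<in> lp_fun M p" for n
    using assms by (intro lp_fun_diff) auto
  have eq: "(LINT x|M. w x * (F n x \<bullet> g x)) - (LINT x|M. w x * (f x \<bullet> g x)) =
      (LINT x|M. w x * ((F n x - f x) \<bullet> g x))" for n
    using Holder_weighted_inner(1)[OF \<open>1 < p\<close> f(2) g w] Holder_weighted_inner(1)[OF \<open>1 < p\<close> f(1) g w]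
    by (simp add: inner_diff_left right_diff_distrib)
  have "(\<lambda>n. (LINT x|M. w x * (F n x \<bullet> g x)) - (LINT x|M. w x * (f x \<bullet> g x))) \<longlonglongrightarrow> 0"
    unfolding eq
  proof (rule Lim_null_comparison)
    show "\<forall>\<^sub>F n in sequentially. norm (LINT x|M. w x * ((F n x - f x) \<bullet> g x)) \<le>
        K * (lp_norm M p (\<lambda>x. F n x - f x) * lp_norm M (p / (p - 1)) g)"
      using Holder_weighted_inner(2)[OF \<open>1 < p\<close> d g w] by (auto intro!: always_eventually)
    show "(\<lambda>n. K * (lp_norm M p (\<lambda>x. F n x - f x) * lp_norm M (p / (p - 1)) g)) \<longlonglongrightarrow> 0"
      by (intro tendsto_mult_right_zero tendsto_mult_left_zero lim)
  qed
  then show ?thesis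
    by (simp add: LIM_zero_iff)
qed

text \<open>
  Convergence of \<open>U n\<close> in \<open>L\<^sup>p\<close> passes through a Lipschitz function, so the Hoelder inequality replaces
  the extraction of an almost everywhere convergent subsequence.
\<close>

lemma tendsto_Lipschitz_compose:
  fixes a u :: "'a \<Rightarrow> real" and \<theta> :: "real \<Rightarrow> real"
  assumes "finite_measure M" "1 < p" and u: "u \<in> lp_fun M p" "\<And>n. U n \<in> lp_fun M p"
    and a: "a \<in> lp_fun M (p / (p - 1))"
    and lim: "(\<lambda>n. lp_norm M p (\<lambda>x. U n x - u x)) \<longlonglongrightarrow> 0"
    and \<theta>: "continuous_on UNIV \<theta>" "\<And>s. \<bar>\<theta> s\<bar> \<le> K" and lip: "\<And>s t. \<bar>\<theta> s - \<theta> t\<bar> \<le> L * \<bar>s - t\<bar>"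
  shows "(\<lambda>n. LINT x|M. \<theta> (U n x) * a x) \<longlonglongrightarrow> (LINT x|M. \<theta> (u x) * a x)"
proof -
  interpret finite_measure M by fact
  have one: "(\<lambda>_. 1::real) \<in> lp_fun M p"
    using \<open>1 < p\<close> by (intro lp_fun_bounded) (auto simp: finite_measure_axioms)
  have [measurable]: "\<theta> \<in> borel_measurable borel" "u \<in> borel_measurable M" "\<And>n. U n \<in> borel_measurable M"
      "a \<in> borel_measurable M"
    using u a \<theta>(1) by (auto simp: lp_fun_def borel_measurable_continuous_onI)
  have int: "integrable M (\<lambda>x. \<theta> (v x) * a x)" if [measurable]: "v \<in> borel_measurable M" for v
    using Holder_weighted_inner(1)[OF \<open>1 < p\<close> one a, of "\<lambda>x. \<theta> (v x)" K] \<theta>(2) by simp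
  have d: "(\<lambda>x. U n x - u x) \<in> lp_fun M p" for n
    using assms by (intro lp_fun_diff) auto
  have "(\<lambda>n. (LINT x|M. \<theta> (U n x) * a x) - (LINT x|M. \<theta> (u x) * a x)) \<longlonglongrightarrow> 0"
  proof (rule Lim_null_comparison)
    show "\<forall>\<^sub>F n in sequentially. norm ((LINT x|M. \<theta> (U n x) * a x) - (LINT x|M. \<theta> (u x) * a x)) \<le>
        L * (lp_norm M p (\<lambda>x. U n x - u x) * lp_norm M (p / (p - 1)) a)"
    proof (intro always_eventually allI)
      fix n
      have L: "0 \<le> L"
        using lip[of 0 1] by simp
      have "norm ((LINT x|M. \<theta> (U n x) * a x) - (LINT x|M. \<theta> (u x) * a x)) =
          \<bar>LINT x|M. (\<theta> (U n x) - \<theta> (u x)) * a x\<bar>"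
        using int[of "U n"] int[of u] by (simp add: left_diff_distrib)
      also have "\<dots> \<le> (LINT x|M. L * (norm (U n x - u x) * norm (a x)))"
      proof (rule order_trans[OF integral_abs_bound], rule integral_mono)
        show "integrable M (\<lambda>x. \<bar>(\<theta> (U n x) - \<theta> (u x)) * a x\<bar>)"
          using int[of "U n"] int[of u] by (simp add: left_diff_distrib)
        show "integrable M (\<lambda>x. L * (norm (U n x - u x) * norm (a x)))"
          using Holder_norm(1)[OF \<open>1 < p\<close> d a] by simp
        show "\<bar>(\<theta> (U n x) - \<theta> (u x)) * a x\<bar> \<le> L * (norm (U n x - u x) * norm (a x))" for x
          using mult_right_mono[OF lip[of "U n x" "u x"], of "\<bar>a x\<bar>"] by (simp add: abs_mult mult.assoc)
      qed
      also have "\<dots> \<le> L * (lp_norm M p (\<lambda>x. U n x - u x) * lp_norm M (p / (p - 1)) a)"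
        using Holder_norm(2)[OF \<open>1 < p\<close> d a] L by (simp add: mult_left_mono)
      finally show "norm ((LINT x|M. \<theta> (U n x) * a x) - (LINT x|M. \<theta> (u x) * a x)) \<le> \<dots>" .
    qed
    show "(\<lambda>n. L * (lp_norm M p (\<lambda>x. U n x - u x) * lp_norm M (p / (p - 1)) a)) \<longlonglongrightarrow> 0"
      by (intro tendsto_mult_right_zero tendsto_mult_left_zero lim)
  qed
  then show ?thesis
    by (simp add: LIM_zero_iff)
qed

section \<open>Gradients in Hilbert space\<close>

text \<open>
  The representative is the minimiser of \<open>J(u) = \<parallel>u\<parallel>\<^sup>2 / 2 - l(u)\<close>. By the parallelogram law,
  \<open>\<parallel>a - b\<parallel>\<^sup>2\<close> is four times the sum of \<open>J(a)\<close> and \<open>J(b)\<close> minus eight times \<open>J\<close> at the midpoint, so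
  minimising sequences are Cauchy; at a minimiser the first variation \<open>y \<bullet> v - l(y)\<close> vanishes.
\<close>

lemma Riesz_representation:
  fixes l :: "'a::{real_inner, complete_space} \<Rightarrow> real"
  assumes "bounded_linear l"
  shows "\<exists>v. \<forall>y. l y = y \<bullet> v"
proof -
  interpret l: bounded_linear l by fact
  define J where "J u = (norm u)\<^sup>2 / 2 - l u" for u
  obtain K where K: "\<And>x. norm (l x) \<le> norm x * K"
    using l.bounded by auto
  have J_ge: "- K\<^sup>2 / 2 \<le> J u" for u
  proof -
    have "l u \<le> norm u * K"
      using K[of u] by simp
    moreover have "0 \<le> (norm u - K)\<^sup>2"
      by simp
    ultimately show ?thesis
      unfolding J_def power2_diff by (simp add: field_simps)
  qed
  define m where "m = Inf (range J)"
  have bdd: "bdd_below (range J)"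
    using J_ge by (auto intro!: bdd_belowI2)
  have m: "m \<le> J u" for u
    unfolding m_def using bdd by (intro cInf_lower) auto
  have "\<exists>u. J u < m + inverse (real (Suc n))" for n
    using cInf_lessD[of "range J" "m + inverse (real (Suc n))"] by (auto simp: m_def)
  then obtain u where u: "\<And>n. J (u n) < m + inverse (real (Suc n))"
    by metis
  have par: "(norm (a - b))\<^sup>2 = 4 * (J a + J b) - 8 * J ((1/2) *\<^sub>R (a + b))" for a b
    unfolding J_def power2_norm_eq_inner
    by (simp add: l.add l.scaleR inner_add_left inner_add_right inner_diff_left inner_diff_right
        inner_commute field_simps)
  have "Cauchy u"
  proof (rule metric_CauchyI)
    fix e :: real assume "0 < e"
    then obtain N where N: "inverse (real (Suc N)) < e\<^sup>2 / 8"
      using reals_Archimedean[of "e\<^sup>2 / 8"] by auto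
    show "\<exists>N. \<forall>i\<ge>N. \<forall>j\<ge>N. dist (u i) (u j) < e"
    proof (intro exI[of _ N] allI impI)
      fix i j assume "N \<le> i" "N \<le> j"
      then have "inverse (real (Suc i)) \<le> inverse (real (Suc N))" "inverse (real (Suc j)) \<le> inverse (real (Suc N))"
        by (auto intro!: le_imp_inverse_le)
      then have "J (u i) < m + e\<^sup>2 / 8" "J (u j) < m + e\<^sup>2 / 8"
        using u[of i] u[of j] N
        by (meson add_left_mono add_strict_left_mono less_le_trans less_trans order_le_less_trans)+
      then have "(norm (u i - u j))\<^sup>2 < 4 * ((m + e\<^sup>2 / 8) + (m + e\<^sup>2 / 8)) - 8 * m"
        unfolding par using m[of "(1/2) *\<^sub>R (u i + u j)"] by argo
      then have "(norm (u i - u j))\<^sup>2 < e\<^sup>2"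
        by simp
      then show "dist (u i) (u j) < e"
        using \<open>0 < e\<close> by (simp add: dist_norm power2_less_imp_less)
    qed
  qed
  then obtain v where v: "u \<longlonglongrightarrow> v"
    by (auto simp: Cauchy_convergent_iff convergent_def)
  have "(\<lambda>n. J (u n)) \<longlonglongrightarrow> J v"
    unfolding J_def by (intro tendsto_intros v l.tendsto) simp
  moreover have "(\<lambda>n. m + inverse (real (Suc n))) \<longlonglongrightarrow> m + 0"
    by (intro tendsto_intros LIMSEQ_inverse_real_of_nat)
  ultimately have "J v \<le> m"
    using LIMSEQ_le[OF _ _ exI[of _ 0]] u by (metis (no_types, lifting) add.right_neutral less_imp_le)
  then have min: "J v \<le> J w" for w
    using m[of w] by linarith
  have "l y = y \<bullet> v" for y
  proof -
    define c where "c = y \<bullet> v - l y"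
    have quad: "0 \<le> t * c + t\<^sup>2 * ((norm y)\<^sup>2 / 2)" for t
      using min[of "v + t *\<^sub>R y"] unfolding J_def c_def
      by (simp add: l.add l.scaleR power2_norm_eq_inner inner_add_left inner_add_right inner_commute)
         (simp add: algebra_simps power2_eq_square)
    have "c = 0"
    proof (cases "y = 0")
      case True
      then show ?thesis by (simp add: c_def l.zero)
    next
      case False
      define N where "N = (norm y)\<^sup>2"
      have "0 < N" using False by (simp add: N_def)
      \<comment> \<open>\<open>t = - c / N\<close> minimises the quadratic polynomial.\<close>
      have "(- c / N) * c + (- c / N)\<^sup>2 * (N / 2) = - (c\<^sup>2 / (2 * N))"
        using \<open>0 < N\<close> by (simp add: field_simps power2_eq_square)
      then have "c\<^sup>2 / (2 * N) \<le> 0"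
        using quad[of "- c / N"] by (simp add: N_def)
      then show ?thesis
        using \<open>0 < N\<close> by (simp add: divide_le_0_iff)
    qed
    then show ?thesis by (simp add: c_def)
  qed
  then show ?thesis by blast
qed

text \<open>
  By the Riesz representation the derivative is the inner product with some vector, so the description
  defining \<open>grad\<close> denotes; this is where completeness of the space is used.
\<close>

lemma GDERIV_grad:
  fixes f :: "'a::{real_inner, complete_space} \<Rightarrow> real"
  assumes "f differentiable (at x)"
  shows "GDERIV f x :> grad f x"
proof -
  obtain f' where f': "(f has_derivative f') (at x)"
    using assms by (auto simp: differentiable_def)
  obtain v where v: "\<And>y. f' y = y \<bullet> v"
    using Riesz_representation[OF has_derivative_bounded_linear[OF f']] by blast
  have "GDERIV f x :> v"
    using f' v unfolding gderiv_def by (metis (no_types, lifting) ext)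
  moreover have "w = v" if "GDERIV f x :> w" for w
  proof -
    have "(\<lambda>h. h \<bullet> w) = f'"
      using that f' unfolding gderiv_def by (rule has_derivative_unique)
    then have "(w - v) \<bullet> (w - v) = 0"
      by (metis inner_diff_right v right_minus_eq)
    then show ?thesis by simp
  qed
  ultimately show ?thesis
    unfolding grad_def by (metis (mono_tags, lifting) theI)
qed

lemma grad_eqI:
  fixes f :: "'a::{real_inner, complete_space} \<Rightarrow> real"
  assumes "GDERIV f x :> v"
  shows "grad f x = v"
proof -
  have "f differentiable (at x)"
    using assms by (auto simp: gderiv_def differentiable_def)
  then have "(\<lambda>h. h \<bullet> grad f x) = (\<lambda>h. h \<bullet> v)"
    using GDERIV_grad[of f x] assms unfolding gderiv_def by (intro has_derivative_unique) auto
  then have "(grad f x - v) \<bullet> (grad f x - v) = 0"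
    by (metis inner_diff_right right_minus_eq)
  then show ?thesis by simp
qed

lemma C1b_iff:
  fixes f :: "'a::{real_inner, complete_space} \<Rightarrow> real"
  shows "f \<in> C1b \<longleftrightarrow> (\<exists>D. bounded (range f) \<and> (\<forall>x. GDERIV f x :> D x) \<and>
     continuous_on UNIV D \<and> bounded (range D))"
proof
  assume "f \<in> C1b"
  then show "\<exists>D. bounded (range f) \<and> (\<forall>x. GDERIV f x :> D x) \<and>
     continuous_on UNIV D \<and> bounded (range D)"
    by (intro exI[of _ "grad f"]) (auto simp: C1b_def GDERIV_grad)
next
  assume "\<exists>D. bounded (range f) \<and> (\<forall>x. GDERIV f x :> D x) \<and>
     continuous_on UNIV D \<and> bounded (range D)"
  then obtain D where D: "bounded (range f)" "\<And>x. GDERIV f x :> D x"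
     "continuous_on UNIV D" "bounded (range D)"
    by blast
  have "grad f = D"
    using D(2) by (auto intro!: ext grad_eqI)
  then show "f \<in> C1b"
    using D by (auto simp: C1b_def gderiv_def differentiable_def)
qed

lemma C1bD:
  fixes f :: "'a::{real_inner, complete_space} \<Rightarrow> real"
  assumes "f \<in> C1b"
  shows "bounded (range f)" "GDERIV f x :> grad f x" "continuous_on UNIV (grad f)"
    "bounded (range (grad f))" "continuous_on UNIV f"
proof -
  show *: "bounded (range f)" "GDERIV f x :> grad f x" "continuous_on UNIV (grad f)"
    "bounded (range (grad f))" for x
    using assms by (auto simp: C1b_def GDERIV_grad)
  show "continuous_on UNIV f"
    using *(2) unfolding gderiv_def
    by (auto intro!: continuous_at_imp_continuous_on has_derivative_continuous)
qed

lemma C1b_const: "(\<lambda>_. c) \<in> (C1b :: ('a::{real_inner, complete_space} \<Rightarrow> real) set)"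
  unfolding C1b_iff by (intro exI[of _ "\<lambda>_. 0"]) (auto simp: GDERIV_const)

lemma C1b_diff:
  fixes f g :: "'a::{real_inner, complete_space} \<Rightarrow> real"
  assumes "f \<in> C1b" "g \<in> C1b"
  shows "(\<lambda>x. f x - g x) \<in> C1b" "grad (\<lambda>x. f x - g x) x = grad f x - grad g x"
proof -
  note f = C1bD[OF assms(1)] and g = C1bD[OF assms(2)]
  show "(\<lambda>x. f x - g x) \<in> C1b"
    unfolding C1b_iff
    by (intro exI[of _ "\<lambda>x. grad f x - grad g x"] conjI allI GDERIV_diff continuous_intros
        bounded_minus_comp f g)
  show "grad (\<lambda>x. f x - g x) x = grad f x - grad g x"
    by (intro grad_eqI GDERIV_diff f g)
qed

text \<open>
  With \<open>u\<close> approximating \<open>g\<close>, these products are the test functions for which the adjoint identity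
  is evaluated.
\<close>

lemma C1b_mult_compose:
  fixes f u :: "'a::{real_inner, complete_space} \<Rightarrow> real"
  assumes "f \<in> C1b" "u \<in> C1b"
    and \<theta>: "\<And>s. DERIV \<theta> s :> \<theta>' s" "continuous_on UNIV \<theta>'" "\<And>s. \<bar>\<theta> s\<bar> \<le> K" "\<And>s. \<bar>\<theta>' s\<bar> \<le> K'"
  shows "(\<lambda>x. f x * \<theta> (u x)) \<in> C1b"
    and "grad (\<lambda>x. f x * \<theta> (u x)) x = \<theta> (u x) *\<^sub>R grad f x + (f x * \<theta>' (u x)) *\<^sub>R grad u x"
proof -
  note f = C1bD[OF assms(1)] and u = C1bD[OF assms(2)]
  obtain Kf Kf' Ku' where K: "\<And>x. \<bar>f x\<bar> \<le> Kf" "\<And>x. norm (grad f x) \<le> Kf'" "\<And>x. norm (grad u x) \<le> Ku'"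
    using f(1,4) u(4) by (auto simp: bounded_iff)
  have d: "GDERIV (\<lambda>x. f x * \<theta> (u x)) x :> \<theta> (u x) *\<^sub>R grad f x + (f x * \<theta>' (u x)) *\<^sub>R grad u x" for x
    using GDERIV_mult[OF f(2) GDERIV_DERIV_compose[OF u(2) \<theta>(1)], of x]
    by (simp add: add.commute)
  then show "grad (\<lambda>x. f x * \<theta> (u x)) x = \<theta> (u x) *\<^sub>R grad f x + (f x * \<theta>' (u x)) *\<^sub>R grad u x"
    by (rule grad_eqI)
  have cont: "continuous_on UNIV \<theta>"
    using \<theta>(1) by (meson DERIV_isCont continuous_at_imp_continuous_on)
  show "(\<lambda>x. f x * \<theta> (u x)) \<in> C1b"
    unfolding C1b_iff
  proof (intro exI[of _ "\<lambda>x. \<theta> (u x) *\<^sub>R grad f x + (f x * \<theta>' (u x)) *\<^sub>R grad u x"] conjI allI)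
    show "GDERIV (\<lambda>x. f x * \<theta> (u x)) x :> \<theta> (u x) *\<^sub>R grad f x + (f x * \<theta>' (u x)) *\<^sub>R grad u x" for x
      by (rule d)
    show "bounded (range (\<lambda>x. f x * \<theta> (u x)))"
    proof (rule boundedI)
      fix y assume "y \<in> range (\<lambda>x. f x * \<theta> (u x))"
      then obtain x where "y = f x * \<theta> (u x)" by auto
      then show "norm y \<le> Kf * K"
        using mult_mono[OF K(1)[of x] \<theta>(3)[of "u x"]] order_trans[OF abs_ge_zero K(1)[of x]]
        by (simp add: abs_mult)
    qed
    show "continuous_on UNIV (\<lambda>x. \<theta> (u x) *\<^sub>R grad f x + (f x * \<theta>' (u x)) *\<^sub>R grad u x)"
      by (intro continuous_intros f u continuous_on_compose2[OF cont] continuous_on_compose2[OF \<theta>(2)]) auto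
    show "bounded (range (\<lambda>x. \<theta> (u x) *\<^sub>R grad f x + (f x * \<theta>' (u x)) *\<^sub>R grad u x))"
    proof (rule boundedI)
      fix y assume "y \<in> range (\<lambda>x. \<theta> (u x) *\<^sub>R grad f x + (f x * \<theta>' (u x)) *\<^sub>R grad u x)"
      then obtain x where y: "y = \<theta> (u x) *\<^sub>R grad f x + (f x * \<theta>' (u x)) *\<^sub>R grad u x" by auto
      have nn: "0 \<le> K" "0 \<le> Kf"
        using order_trans[OF abs_ge_zero \<theta>(3)[of 0]] order_trans[OF abs_ge_zero K(1)[of x]]
        by auto
      have "norm y \<le> \<bar>\<theta> (u x)\<bar> * norm (grad f x) + (\<bar>f x\<bar> * \<bar>\<theta>' (u x)\<bar>) * norm (grad u x)"
        unfolding y by (rule order_trans[OF norm_triangle_ineq]) (simp add: abs_mult)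
      also have "\<dots> \<le> K * Kf' + (Kf * K') * Ku'"
        using \<theta>(4)[of 0] by (intro add_mono mult_mono K \<theta> mult_nonneg_nonneg nn) auto
      finally show "norm y \<le> K * Kf' + (Kf * K') * Ku'" .
    qed
  qed
qed

section \<open>The operator on smooth functions and its adjoint\<close>

locale R_gradient = finite_measure \<nu>
  for \<nu> :: "'a::{real_inner, complete_space, second_countable_topology} measure" +
  fixes R :: "'a \<Rightarrow> 'a" and p :: real
  assumes sets_eq_borel: "sets \<nu> = sets borel"
    and bounded_linear_R: "bounded_linear R"
    and p_gt_1: "1 < p"
    and closable: "closable_R_grad \<nu> R p"
begin

lemma continuous_imp_measurable:
  fixes f :: "'a \<Rightarrow> 'b::topological_space"
  shows "continuous_on UNIV f \<Longrightarrow> f \<in> borel_measurable \<nu>"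
  unfolding measurable_cong_sets[OF sets_eq_borel refl] by (rule borel_measurable_continuous_onI)

lemma C1b_lp_fun: "f \<in> C1b \<Longrightarrow> 0 < q \<Longrightarrow> f \<in> lp_fun \<nu> q"
  using C1bD[of f] by (intro lp_fun_bounded continuous_imp_measurable) (simp_all add: finite_measure_axioms)

lemma bounded_R_grad:
  assumes "f \<in> C1b"
  shows "bounded (range (\<lambda>x. R (grad f x)))"
proof -
  have "bounded (R ` range (grad f))"
    using bounded_linear_image[OF C1bD(4)[OF assms] bounded_linear_R] .
  then show ?thesis
    by (simp add: image_image)
qed

lemma R_grad_measurable:
  assumes "f \<in> C1b"
  shows "(\<lambda>x. R (grad f x)) \<in> borel_measurable \<nu>"
  by (intro continuous_imp_measurable bounded_linear.continuous_on[OF bounded_linear_R] C1bD(3)[OF assms])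

lemma R_grad_lp_fun: "f \<in> C1b \<Longrightarrow> 0 < q \<Longrightarrow> (\<lambda>x. R (grad f x)) \<in> lp_fun \<nu> q"
  by (intro lp_fun_bounded R_grad_measurable bounded_R_grad) (simp_all add: finite_measure_axioms)

lemma M_graph_C1b:
  assumes "f \<in> C1b"
  shows "M_graph \<nu> R p f (\<lambda>x. R (grad f x))"
  unfolding M_graph_def
  using assms p_gt_1 by (auto simp: C1b_lp_fun R_grad_lp_fun lp_norm_def intro!: exI[of _ "\<lambda>_. f"])

lemma M_graph_M_op: "f \<in> W1p \<nu> R p \<Longrightarrow> M_graph \<nu> R p f (M_op \<nu> R p f)"
  using someI_ex[of "M_graph \<nu> R p f"] by (simp add: W1p_def M_op_def)

text \<open>
  Subtracting \<open>f\<close> from a sequence approximating \<open>(f, M_op f)\<close> leaves a sequence in \<open>C1b\<close> whose limit is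
  \<open>(0, M_op f - R\<nabla>f)\<close>, and closability applies.
\<close>

lemma M_op_C1b:
  assumes "f \<in> C1b"
  shows "AE x in \<nu>. M_op \<nu> R p f x = R (grad f x)"
proof -
  interpret R: bounded_linear R by (rule bounded_linear_R)
  have "M_graph \<nu> R p f (M_op \<nu> R p f)"
    using M_graph_C1b[OF assms] by (intro M_graph_M_op) (auto simp: W1p_def)
  then obtain u where F: "M_op \<nu> R p f \<in> lp_fun \<nu> p" and u: "\<And>n. u n \<in> C1b"
    "(\<lambda>n. lp_norm \<nu> p (\<lambda>x. u n x - f x)) \<longlonglongrightarrow> 0"
    "(\<lambda>n. lp_norm \<nu> p (\<lambda>x. R (grad (u n) x) - M_op \<nu> R p f x)) \<longlonglongrightarrow> 0"
    unfolding M_graph_def by blast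
  have "M_graph \<nu> R p (\<lambda>_. 0) (\<lambda>x. M_op \<nu> R p f x - R (grad f x))"
    unfolding M_graph_def
  proof (intro conjI exI[of _ "\<lambda>n x. u n x - f x"] allI)
    show "(\<lambda>_. 0::real) \<in> lp_fun \<nu> p"
      by (simp add: lp_fun_def)
    show "(\<lambda>x. M_op \<nu> R p f x - R (grad f x)) \<in> lp_fun \<nu> p"
      using p_gt_1 by (intro lp_fun_diff F R_grad_lp_fun assms) auto
    show "(\<lambda>x. u n x - f x) \<in> C1b" for n
      by (intro C1b_diff u assms)
    show "(\<lambda>n. lp_norm \<nu> p (\<lambda>x. u n x - f x - 0)) \<longlonglongrightarrow> 0"
      using u by simp
    show "(\<lambda>n. lp_norm \<nu> p (\<lambda>x. R (grad (\<lambda>x. u n x - f x) x) - (M_op \<nu> R p f x - R (grad f x)))) \<longlonglongrightarrow> 0"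
      using u by (simp add: C1b_diff(2)[OF u(1) assms] R.diff)
  qed
  then show ?thesis
    using closable by (auto simp: closable_R_grad_def)
qed

lemma adjoint_C1b:
  assumes adj: "M_adj_graph \<nu> R p \<Psi> h" and f: "f \<in> C1b"
  shows "(LINT x|\<nu>. R (grad f x) \<bullet> \<Psi> x) = (LINT x|\<nu>. f x * h x)"
proof -
  have [measurable]: "\<Psi> \<in> borel_measurable \<nu>" "(\<lambda>x. R (grad f x)) \<in> borel_measurable \<nu>"
    using adj R_grad_measurable[OF f] by (auto simp: M_adj_graph_def lp_fun_def)
  have W: "f \<in> W1p \<nu> R p"
    using M_graph_C1b[OF f] by (auto simp: W1p_def)
  then have [measurable]: "M_op \<nu> R p f \<in> borel_measurable \<nu>"
    using M_graph_M_op by (auto simp: M_graph_def lp_fun_def)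
  have "(LINT x|\<nu>. R (grad f x) \<bullet> \<Psi> x) = (LINT x|\<nu>. M_op \<nu> R p f x \<bullet> \<Psi> x)"
    using M_op_C1b[OF f] by (intro integral_cong_AE) (measurable, auto)
  then show ?thesis
    using adj W by (simp add: M_adj_graph_def)
qed

end

section \<open>Integration by parts along a transversal field\<close>

text \<open>
  \<open>\<Psi>\<close> is any field in the domain of the adjoint along which \<open>g\<close> grows at unit rate, in the sense that
  \<open>\<langle>G, \<Psi>\<rangle> = 1\<close> for the weak gradient \<open>G\<close> of \<open>g\<close>; \<open>h\<close> is its divergence up to sign.
\<close>

locale transversal_field = R_gradient \<nu> R p
  for \<nu> :: "'a::{real_inner, complete_space, second_countable_topology} measure" and R p +
  fixes g :: "'a \<Rightarrow> real" and G \<Psi> :: "'a \<Rightarrow> 'a" and h :: "'a \<Rightarrow> real"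
  assumes graph_g: "M_graph \<nu> R p g G"
    and adj: "M_adj_graph \<nu> R p \<Psi> h"
    and unit_speed: "AE x in \<nu>. G x \<bullet> \<Psi> x = 1"
begin

lemma conj_gt_1: "1 < p / (p - 1)"
  using p_gt_1 by (simp add: field_simps)

lemma g_lp: "g \<in> lp_fun \<nu> p" and G_lp: "G \<in> lp_fun \<nu> p"
  and Psi_lp: "\<Psi> \<in> lp_fun \<nu> (p / (p - 1))" and h_lp: "h \<in> lp_fun \<nu> (p / (p - 1))"
  using graph_g adj by (auto simp: M_graph_def M_adj_graph_def)

lemma measurables [measurable]: "g \<in> borel_measurable \<nu>" "G \<in> borel_measurable \<nu>"
  "\<Psi> \<in> borel_measurable \<nu>" "h \<in> borel_measurable \<nu>"
  using g_lp G_lp Psi_lp h_lp by (auto simp: lp_fun_def)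

context
  fixes \<theta> \<theta>' :: "real \<Rightarrow> real" and K K' L :: real
  assumes \<theta>_deriv: "\<And>s. DERIV \<theta> s :> \<theta>' s"
    and \<theta>_bound: "\<And>s. \<bar>\<theta> s\<bar> \<le> K"
    and \<theta>'_bound: "\<And>s. \<bar>\<theta>' s\<bar> \<le> K'"
    and \<theta>'_Lipschitz: "\<And>s t. \<bar>\<theta>' s - \<theta>' t\<bar> \<le> L * \<bar>s - t\<bar>"
begin

lemma \<theta>_cont: "continuous_on UNIV \<theta>"
  using \<theta>_deriv by (meson DERIV_isCont continuous_at_imp_continuous_on)

lemma \<theta>'_cont: "continuous_on UNIV \<theta>'"
proof -
  have "(max L 0)-lipschitz_on UNIV \<theta>'"
  proof (rule lipschitz_onI)
    show "dist (\<theta>' s) (\<theta>' t) \<le> max L 0 * dist s t" for s t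
      using order_trans[OF \<theta>'_Lipschitz[of s t] mult_right_mono[of L "max L 0"]]
      by (simp add: dist_real_def)
  qed simp
  then show ?thesis
    by (rule lipschitz_on_continuous_on)
qed

lemma \<theta>_Lipschitz: "\<bar>\<theta> s - \<theta> t\<bar> \<le> K' * \<bar>s - t\<bar>"
  using field_differentiable_bound[of UNIV \<theta> \<theta>' K' s t] \<theta>_deriv \<theta>'_bound by simp

lemma [measurable]: "\<theta> \<in> borel_measurable borel" "\<theta>' \<in> borel_measurable borel"
  using \<theta>_cont \<theta>'_cont by (auto intro: borel_measurable_continuous_onI)

text \<open>
  With \<open>u\<^sub>n \<rightarrow> g\<close> in \<open>C1b\<close>, the adjoint identity for \<open>f \<theta>(u\<^sub>n)\<close> contains the term
  \<open>\<integral> f \<theta>'(u\<^sub>n) \<langle>R\<nabla>u\<^sub>n, \<Psi>\<rangle> d\<nu>\<close>, a product of two factors that both converge only in the mean.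
  Writing \<open>\<langle>R\<nabla>u\<^sub>n, \<Psi>\<rangle> = \<langle>R\<nabla>u\<^sub>n - G, \<Psi>\<rangle> + 1\<close> resolves this: the first part tends to \<open>0\<close> against
  bounded weights, and the second leaves \<open>\<integral> f \<theta>'(u\<^sub>n) d\<nu>\<close>, which converges because \<open>\<theta>'\<close> is Lipschitz.
\<close>

lemma integration_by_parts_C1b:
  assumes f: "f \<in> C1b"
  shows "(LINT x|\<nu>. \<theta>' (g x) * f x) =
    (LINT x|\<nu>. \<theta> (g x) * (f x * h x)) - (LINT x|\<nu>. \<theta> (g x) * (R (grad f x) \<bullet> \<Psi> x))"
proof -
  interpret R: bounded_linear R by (rule bounded_linear_R)
  note p = p_gt_1
  from graph_g obtain u where u: "\<And>n. u n \<in> C1b"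
    "(\<lambda>n. lp_norm \<nu> p (\<lambda>x. u n x - g x)) \<longlonglongrightarrow> 0"
    "(\<lambda>n. lp_norm \<nu> p (\<lambda>x. R (grad (u n) x) - G x)) \<longlonglongrightarrow> 0"
    unfolding M_graph_def by blast
  have u_lp: "u n \<in> lp_fun \<nu> p" and Ru_lp: "(\<lambda>x. R (grad (u n) x)) \<in> lp_fun \<nu> p" for n
    using u p by (auto intro: C1b_lp_fun R_grad_lp_fun)
  have [measurable]: "u n \<in> borel_measurable \<nu>" for n
    using u_lp by (simp add: lp_fun_def)
  have f_meas [measurable]: "f \<in> borel_measurable \<nu>" "(\<lambda>x. R (grad f x)) \<in> borel_measurable \<nu>"
    using C1b_lp_fun[OF f, of 1] R_grad_measurable[OF f] by (auto simp: lp_fun_def)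
  obtain C D where C: "\<And>x. \<bar>f x\<bar> \<le> C" and D: "\<And>x. norm (R (grad f x)) \<le> D"
    using C1bD(1)[OF f] bounded_R_grad[OF f] by (auto simp: bounded_iff)
  have C0: "0 \<le> C"
    using C[of undefined] by linarith
  have weight: "\<bar>f x * \<theta>' s\<bar> \<le> C * K'" for x s
    using mult_mono[OF C[of x] \<theta>'_bound[of s]] C0 by (simp add: abs_mult)
  have fh: "(\<lambda>x. f x * h x) \<in> lp_fun \<nu> (p / (p - 1))"
    using conj_gt_1
    by (intro lp_fun_dominated[OF _ h_lp, where K=C]) (auto simp: abs_mult intro!: mult_right_mono C)
  have RfPsi: "(\<lambda>x. R (grad f x) \<bullet> \<Psi> x) \<in> lp_fun \<nu> (p / (p - 1))"
    using conj_gt_1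
    by (intro lp_fun_dominated[OF _ Psi_lp, where K=D])
       (auto intro!: mult_right_mono D order_trans[OF Cauchy_Schwarz_ineq2])
  have f_lp: "f \<in> lp_fun \<nu> (p / (p - 1))"
    using conj_gt_1 by (intro C1b_lp_fun f) auto
  have id: "(LINT x|\<nu>. \<theta> (u n x) * (f x * h x)) = (LINT x|\<nu>. \<theta> (u n x) * (R (grad f x) \<bullet> \<Psi> x)) +
     (LINT x|\<nu>. (f x * \<theta>' (u n x)) * (R (grad (u n) x) \<bullet> \<Psi> x))" for n
  proof -
    note prod = C1b_mult_compose[OF f u(1) \<theta>_deriv \<theta>'_cont \<theta>_bound \<theta>'_bound]
    have "(LINT x|\<nu>. \<theta> (u n x) * (f x * h x)) = (LINT x|\<nu>. (f x * \<theta> (u n x)) * h x)"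
      by (simp add: mult_ac)
    also have "\<dots> = (LINT x|\<nu>. R (grad (\<lambda>x. f x * \<theta> (u n x)) x) \<bullet> \<Psi> x)"
      using adjoint_C1b[OF adj prod(1)] by simp
    also have "\<dots> = (LINT x|\<nu>. \<theta> (u n x) * (R (grad f x) \<bullet> \<Psi> x) +
        (f x * \<theta>' (u n x)) * (R (grad (u n) x) \<bullet> \<Psi> x))"
      by (simp add: prod(2) R.add R.scaleR inner_add_left)
    also have "\<dots> = (LINT x|\<nu>. \<theta> (u n x) * (R (grad f x) \<bullet> \<Psi> x)) +
        (LINT x|\<nu>. (f x * \<theta>' (u n x)) * (R (grad (u n) x) \<bullet> \<Psi> x))"
      using Holder_weighted_inner(1)[OF p R_grad_lp_fun[OF f] Psi_lp, of "\<lambda>x. \<theta> (u n x)" K] p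
        Holder_weighted_inner(1)[OF p Ru_lp Psi_lp, of "\<lambda>x. f x * \<theta>' (u n x)" "C * K'" n] weight \<theta>_bound
      by (intro Bochner_Integration.integral_add) auto
    finally show ?thesis .
  qed
  have "(\<lambda>n. LINT x|\<nu>. (f x * \<theta>' (u n x)) * (R (grad (u n) x) \<bullet> \<Psi> x)) \<longlonglongrightarrow> (LINT x|\<nu>. \<theta>' (g x) * f x)"
  proof -
    have d: "(\<lambda>x. R (grad (u n) x) - G x) \<in> lp_fun \<nu> p" for n
      using p by (intro lp_fun_diff Ru_lp G_lp) auto
    have split: "(LINT x|\<nu>. (f x * \<theta>' (u n x)) * (R (grad (u n) x) \<bullet> \<Psi> x)) =
        (LINT x|\<nu>. (f x * \<theta>' (u n x)) * ((R (grad (u n) x) - G x) \<bullet> \<Psi> x)) + (LINT x|\<nu>. \<theta>' (u n x) * f x)" for n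
    proof -
      have "(LINT x|\<nu>. \<theta>' (u n x) * f x) = (LINT x|\<nu>. (f x * \<theta>' (u n x)) * (G x \<bullet> \<Psi> x))"
        using unit_speed by (intro integral_cong_AE) (measurable, auto)
      then show ?thesis
        using Holder_weighted_inner(1)[OF p d Psi_lp, of "\<lambda>x. f x * \<theta>' (u n x)" "C * K'" n]
          Holder_weighted_inner(1)[OF p G_lp Psi_lp, of "\<lambda>x. f x * \<theta>' (u n x)" "C * K'"] weight
        by (simp add: inner_diff_left right_diff_distrib flip: Bochner_Integration.integral_add)
    qed
    have "(\<lambda>n. LINT x|\<nu>. (f x * \<theta>' (u n x)) * ((R (grad (u n) x) - G x) \<bullet> \<Psi> x)) \<longlonglongrightarrow> 0"
    proof (rule Lim_null_comparison)
      show "\<forall>\<^sub>F n in sequentially. norm (LINT x|\<nu>. (f x * \<theta>' (u n x)) * ((R (grad (u n) x) - G x) \<bullet> \<Psi> x)) \<le>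
          C * K' * (lp_norm \<nu> p (\<lambda>x. R (grad (u n) x) - G x) * lp_norm \<nu> (p / (p - 1)) \<Psi>)"
        using Holder_weighted_inner(2)[OF p d Psi_lp, of "\<lambda>x. f x * \<theta>' (u n x)" "C * K'" n for n] weight
        by (intro always_eventually allI) simp
      show "(\<lambda>n. C * K' * (lp_norm \<nu> p (\<lambda>x. R (grad (u n) x) - G x) * lp_norm \<nu> (p / (p - 1)) \<Psi>)) \<longlonglongrightarrow> 0"
        by (intro tendsto_mult_right_zero tendsto_mult_left_zero u)
    qed
    from tendsto_add[OF this tendsto_Lipschitz_compose[OF finite_measure_axioms p g_lp u_lp f_lp u(2)
          \<theta>'_cont \<theta>'_bound \<theta>'_Lipschitz]]
    show ?thesis
      by (simp add: split)
  qed
  moreover have "(\<lambda>n. LINT x|\<nu>. \<theta> (u n x) * (R (grad f x) \<bullet> \<Psi> x)) \<longlonglongrightarrow> (LINT x|\<nu>. \<theta> (g x) * (R (grad f x) \<bullet> \<Psi> x))"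
    by (rule tendsto_Lipschitz_compose[OF finite_measure_axioms p g_lp u_lp RfPsi u(2) \<theta>_cont \<theta>_bound \<theta>_Lipschitz])
  moreover have "(\<lambda>n. LINT x|\<nu>. \<theta> (u n x) * (f x * h x)) \<longlonglongrightarrow> (LINT x|\<nu>. \<theta> (g x) * (f x * h x))"
    by (rule tendsto_Lipschitz_compose[OF finite_measure_axioms p g_lp u_lp fh u(2) \<theta>_cont \<theta>_bound \<theta>_Lipschitz])
  ultimately have "(LINT x|\<nu>. \<theta> (g x) * (f x * h x)) =
      (LINT x|\<nu>. \<theta> (g x) * (R (grad f x) \<bullet> \<Psi> x)) + (LINT x|\<nu>. \<theta>' (g x) * f x)"
    unfolding id by (intro LIMSEQ_unique[OF _ tendsto_add])
  then show ?thesis by simp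
qed

lemma integration_by_parts:
  assumes "M_graph \<nu> R p f F"
  shows "(LINT x|\<nu>. \<theta>' (g x) * f x) =
    (LINT x|\<nu>. \<theta> (g x) * (f x * h x)) - (LINT x|\<nu>. \<theta> (g x) * (F x \<bullet> \<Psi> x))"
proof -
  note p = p_gt_1
  from assms obtain u where lp: "f \<in> lp_fun \<nu> p" "F \<in> lp_fun \<nu> p" and u: "\<And>n. u n \<in> C1b"
    "(\<lambda>n. lp_norm \<nu> p (\<lambda>x. u n x - f x)) \<longlonglongrightarrow> 0"
    "(\<lambda>n. lp_norm \<nu> p (\<lambda>x. R (grad (u n) x) - F x)) \<longlonglongrightarrow> 0"
    unfolding M_graph_def by blast
  have u_lp: "u n \<in> lp_fun \<nu> p" and Ru_lp: "(\<lambda>x. R (grad (u n) x)) \<in> lp_fun \<nu> p" for n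
    using u p by (auto intro: C1b_lp_fun R_grad_lp_fun)
  have one: "(\<lambda>_. 1::real) \<in> lp_fun \<nu> (p / (p - 1))"
    by (simp add: lp_fun_def)
  have 1: "(\<lambda>n. LINT x|\<nu>. \<theta>' (g x) * u n x) \<longlonglongrightarrow> (LINT x|\<nu>. \<theta>' (g x) * f x)"
    using tendsto_weighted_inner[OF p lp(1) u_lp one _ _ u(2), of "\<lambda>x. \<theta>' (g x)" K'] \<theta>'_bound by simp
  have 2: "(\<lambda>n. LINT x|\<nu>. \<theta> (g x) * (u n x * h x)) \<longlonglongrightarrow> (LINT x|\<nu>. \<theta> (g x) * (f x * h x))"
    using tendsto_weighted_inner[OF p lp(1) u_lp h_lp _ _ u(2), of "\<lambda>x. \<theta> (g x)" K] \<theta>_bound by simp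
  have 3: "(\<lambda>n. LINT x|\<nu>. \<theta> (g x) * (R (grad (u n) x) \<bullet> \<Psi> x)) \<longlonglongrightarrow> (LINT x|\<nu>. \<theta> (g x) * (F x \<bullet> \<Psi> x))"
    using tendsto_weighted_inner[OF p lp(2) Ru_lp Psi_lp _ _ u(3), of "\<lambda>x. \<theta> (g x)" K] \<theta>_bound by simp
  show ?thesis
    using 1 unfolding integration_by_parts_C1b[OF u(1)]
    by (rule LIMSEQ_unique) (intro tendsto_diff 2 3)
qed

text \<open>
  The bound depends on \<open>\<theta>\<close> only through its supremum, so it survives when \<open>\<theta>'\<close> concentrates at a
  point.
\<close>

lemma derivative_weight_bound:
  assumes "M_graph \<nu> R p f F"
  shows "integrable \<nu> (\<lambda>x. \<theta>' (g x) * f x)"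
    and "(LINT x|\<nu>. \<theta>' (g x) * f x) \<le> K * ((lp_norm \<nu> (p / (p - 1)) h + lp_norm \<nu> (p / (p - 1)) \<Psi>) *
      (lp_norm \<nu> p f + lp_norm \<nu> p F))"
proof -
  note p = p_gt_1
  have lp: "f \<in> lp_fun \<nu> p" "F \<in> lp_fun \<nu> p"
    using assms by (auto simp: M_graph_def)
  have one: "(\<lambda>_. 1::real) \<in> lp_fun \<nu> (p / (p - 1))"
    by (simp add: lp_fun_def)
  show "integrable \<nu> (\<lambda>x. \<theta>' (g x) * f x)"
    using Holder_weighted_inner(1)[OF p lp(1) one, of "\<lambda>x. \<theta>' (g x)" K'] \<theta>'_bound by simp
  let ?f = "lp_norm \<nu> p f" and ?F = "lp_norm \<nu> p F"
    and ?h = "lp_norm \<nu> (p / (p - 1)) h" and ?P = "lp_norm \<nu> (p / (p - 1)) \<Psi>"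
  have "(LINT x|\<nu>. \<theta>' (g x) * f x) \<le> K * (?f * ?h) + K * (?F * ?P)"
    unfolding integration_by_parts[OF assms]
    using Holder_weighted_inner(2)[OF p lp(1) h_lp, of "\<lambda>x. \<theta> (g x)" K]
      Holder_weighted_inner(2)[OF p lp(2) Psi_lp, of "\<lambda>x. \<theta> (g x)" K] \<theta>_bound by simp
  also have "\<dots> = K * (?f * ?h + ?F * ?P)"
    by (simp add: distrib_left)
  also have "\<dots> \<le> K * ((?h + ?P) * (?f + ?F))"
    using order_trans[OF abs_ge_zero \<theta>_bound[of 0]]
    by (intro mult_left_mono) (auto simp: algebra_simps lp_norm_nonneg)
  finally show "(LINT x|\<nu>. \<theta>' (g x) * f x) \<le> K * ((?h + ?P) * (?f + ?F))" .
qed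

end

end

section \<open>Comparison of the level measure with the capacity\<close>

lemma arctan_kernel_Lipschitz:
  fixes a b :: real
  shows "\<bar>1 / (1 + a\<^sup>2) - 1 / (1 + b\<^sup>2)\<bar> \<le> \<bar>a - b\<bar>"
proof -
  have pos: "0 < 1 + a\<^sup>2" "0 < 1 + b\<^sup>2"
    by (simp_all add: add_pos_nonneg)
  have "2 * \<bar>x\<bar> \<le> 1 + x\<^sup>2" for x :: real
    using zero_le_power2[of "\<bar>x\<bar> - 1"] by (simp add: power2_diff)
  note this[of a] this[of b]
  then have "\<bar>a + b\<bar> \<le> (1 + a\<^sup>2) + (1 + b\<^sup>2) - 1"
    using zero_le_power2[of a] zero_le_power2[of b] abs_triangle_ineq[of a b] by linarith
  also have "\<dots> \<le> (1 + a\<^sup>2) * (1 + b\<^sup>2)"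
    by (simp add: algebra_simps)
  finally have le: "\<bar>a + b\<bar> / ((1 + a\<^sup>2) * (1 + b\<^sup>2)) \<le> 1"
    using pos by (simp add: divide_le_eq_1)
  have "1 / (1 + a\<^sup>2) - 1 / (1 + b\<^sup>2) = (b - a) * ((a + b) / ((1 + a\<^sup>2) * (1 + b\<^sup>2)))"
    using pos by (simp add: field_simps power2_eq_square)
  then have "\<bar>1 / (1 + a\<^sup>2) - 1 / (1 + b\<^sup>2)\<bar> = \<bar>a - b\<bar> * (\<bar>a + b\<bar> / ((1 + a\<^sup>2) * (1 + b\<^sup>2)))"
    using pos by (simp add: abs_mult abs_minus_commute)
  then show ?thesis
    using mult_left_mono[OF le, of "\<bar>a - b\<bar>"] by simp
qed

text \<open>
  Truncated multiples of the distance to the complement. The case \<open>U = UNIV\<close> is separate because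
  \<open>infdist\<close> to the empty set is \<open>0\<close>.
\<close>

lemma open_indicator_limit_Cb:
  fixes U :: "'a::metric_space set"
  assumes "open U"
  obtains u where "\<And>n::nat. u n \<in> Cb" "\<And>n x. 0 \<le> u n x" "\<And>n x. u n x \<le> indicator U x"
    "\<And>x. (\<lambda>n. u n x) \<longlonglongrightarrow> indicator U x"
proof (cases "U = UNIV")
  case True
  then show ?thesis
    by (intro that[of "\<lambda>_ _. 1"]) (auto simp: Cb_def)
next
  case False
  define u where "u n x = min 1 (real n * infdist x (- U))" for n x
  have closed: "closed (- U)" "- U \<noteq> {}"
    using assms False by auto
  have zero: "infdist x (- U) = 0 \<longleftrightarrow> x \<notin> U" for x
    using in_closed_iff_infdist_zero[OF closed, of x] by simp
  show ?thesis
  proof (rule that[of u])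
    show "u n \<in> Cb" for n
    proof -
      have "continuous_on UNIV (u n)"
        unfolding u_def by (intro continuous_intros)
      moreover have "bounded (range (u n))"
        by (rule boundedI[where B=1]) (auto simp: u_def infdist_nonneg)
      ultimately show ?thesis
        by (simp add: Cb_def)
    qed
    show "0 \<le> u n x" for n x
      by (simp add: u_def infdist_nonneg)
    show "u n x \<le> indicator U x" for n x
      using zero[of x] by (auto simp: u_def indicator_def)
    show "(\<lambda>n. u n x) \<longlonglongrightarrow> indicator U x" for x
    proof (cases "x \<in> U")
      case False
      then show ?thesis
        using zero[of x] by (simp add: u_def)
    next
      case True
      then have pos: "0 < infdist x (- U)"
        using zero[of x] infdist_nonneg[of x "- U"] by linarith
      then obtain N :: nat where N: "1 < real N * infdist x (- U)"
        using reals_Archimedean3 by blast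
      have "u n x = 1" if "N \<le> n" for n
      proof -
        have "real N * infdist x (- U) \<le> real n * infdist x (- U)"
          using that pos by (intro mult_right_mono) auto
        then show ?thesis using N by (simp add: u_def)
      qed
      then have "\<forall>\<^sub>F n in sequentially. u n x = indicator U x"
        using True unfolding eventually_sequentially by auto
      then show ?thesis by (rule tendsto_eventually)
    qed
  qed
qed

text \<open>
  Both infima defining the capacity are over nonempty sets (the constant \<open>1\<close> and the whole space are
  competitors), so each is approached by members of its set.
\<close>

lemma (in R_gradient) W1p_norm_test_function:
  assumes "capacity \<nu> R p B < \<delta>"
  obtains U f where "open U" "B \<subseteq> U" "f \<in> W1p \<nu> R p" "AE x in \<nu>. indicator U x \<le> f x"
    "W1p_norm \<nu> R p f < \<delta>"
proof -
  have "(\<lambda>_. 1) \<in> W1p \<nu> R p"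
    using M_graph_C1b[OF C1b_const] by (auto simp: W1p_def)
  moreover have "AE x in \<nu>. indicator U x \<le> (1::real)" for U
    by (simp add: indicator_def)
  ultimately have ne: "{W1p_norm \<nu> R p f |f. f \<in> W1p \<nu> R p \<and> (AE x in \<nu>. indicator U x \<le> f x)} \<noteq> {}" for U
    by blast
  have "{capacity_open \<nu> R p U |U. open U \<and> B \<subseteq> U} \<noteq> {}"
    by blast
  from cInf_lessD[OF this] assms obtain U where U: "open U" "B \<subseteq> U" "capacity_open \<nu> R p U < \<delta>"
    unfolding capacity_def by blast
  from cInf_lessD[OF ne U(3)[unfolded capacity_open_def]] U(1,2) show ?thesis
    using that by blast
qed

context transversal_field
begin

text \<open>
  The integral of \<open>\<phi>\<close> is the limit of right difference quotients, whose integrand at scale \<open>e\<close> is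
  dominated by \<open>2 \<theta>'(g) f\<close> for \<open>\<theta>(s) = arctan ((s - r) / e)\<close>. As \<open>|\<theta>| \<le> \<pi>/2\<close>, the bound is
  uniform in \<open>e\<close>.
\<close>

lemma level_measure_Cb_bound:
  assumes \<sigma>: "is_level_measure \<nu> g r \<sigma>" and \<phi>: "\<phi> \<in> Cb" "\<And>x. 0 \<le> \<phi> x"
    and f: "M_graph \<nu> R p f F" "AE x in \<nu>. \<phi> x \<le> f x"
  shows "(LINT x|\<sigma>. \<phi> x) \<le> pi * ((lp_norm \<nu> (p / (p - 1)) h + lp_norm \<nu> (p / (p - 1)) \<Psi>) *
      (lp_norm \<nu> p f + lp_norm \<nu> p F))" (is "_ \<le> ?B")
proof -
  define \<Gamma> where "\<Gamma> s = (LINT x:{x. g x \<le> s}|\<nu>. \<phi> x)" for s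
  have [measurable]: "\<phi> \<in> borel_measurable \<nu>"
    using \<phi> by (auto simp: Cb_def intro: continuous_imp_measurable)
  have space: "space \<nu> = UNIV"
    using sets_eq_imp_space_eq[OF sets_eq_borel] by simp
  have [measurable]: "{x. g x \<le> s} \<in> sets \<nu>" for s
    using measurables(1) unfolding borel_measurable_iff_le space by auto
  obtain C where C: "\<And>x. \<bar>\<phi> x\<bar> \<le> C"
    using \<phi> by (auto simp: Cb_def bounded_iff)
  have int: "integrable \<nu> (\<lambda>x. indicator {x. g x \<le> s} x * \<phi> x)" for s
    using order_trans[OF abs_ge_zero C]
    by (intro integrable_const_bound[where B=C]) (auto simp: indicator_def C)
  have quotient: "(\<Gamma> (r + e) - \<Gamma> r) / e \<le> ?B" if e: "0 < e" for e
  proof -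
    define \<theta> where "\<theta> s = arctan ((s - r) / e)" for s
    define k where "k x = 1 / (1 + x\<^sup>2)" for x :: real
    define \<theta>' where "\<theta>' s = k ((s - r) / e) / e" for s
    have k: "0 \<le> k x" "k x \<le> 1" "\<bar>k x - k y\<bar> \<le> \<bar>x - y\<bar>" for x y
      unfolding k_def using arctan_kernel_Lipschitz by (simp_all add: add_pos_nonneg)
    have k_half: "1 / 2 \<le> k x" if "\<bar>x\<bar> \<le> 1" for x
      unfolding k_def using that by (intro divide_left_mono) (auto simp: abs_square_le_1 add_pos_nonneg)
    have d: "DERIV \<theta> s :> \<theta>' s" for s
      unfolding \<theta>_def \<theta>'_def k_def using e
      by (auto intro!: derivative_eq_intros simp: inverse_eq_divide)
    have b: "\<bar>\<theta> s\<bar> \<le> pi / 2" for s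
      unfolding \<theta>_def using arctan_bounded[of "(s - r) / e"] by (auto simp: abs_le_iff)
    have nn: "0 \<le> \<theta>' s" for s
      unfolding \<theta>'_def using e k(1) by simp
    have "\<theta>' s \<le> 1 / e" for s
      unfolding \<theta>'_def using e k(2) by (intro divide_right_mono) auto
    then have b': "\<bar>\<theta>' s\<bar> \<le> 1 / e" for s
      using nn by simp
    have l: "\<bar>\<theta>' s - \<theta>' t\<bar> \<le> 1 / e\<^sup>2 * \<bar>s - t\<bar>" for s t
    proof -
      have "\<bar>\<theta>' s - \<theta>' t\<bar> = \<bar>k ((s - r) / e) - k ((t - r) / e)\<bar> / e"
        unfolding \<theta>'_def using e by (simp flip: diff_divide_distrib)
      also have "\<dots> \<le> \<bar>(s - r) / e - (t - r) / e\<bar> / e"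
        using e by (intro divide_right_mono k) auto
      also have "\<dots> = 1 / e\<^sup>2 * \<bar>s - t\<bar>"
        using e by (simp add: power2_eq_square flip: diff_divide_distrib)
      finally show ?thesis .
    qed
    note int\<theta> = derivative_weight_bound[OF d b b' l f(1)]
    have "(\<Gamma> (r + e) - \<Gamma> r) / e =
        (LINT x|\<nu>. (indicator {x. g x \<le> r + e} x * \<phi> x - indicator {x. g x \<le> r} x * \<phi> x) / e)"
      unfolding \<Gamma>_def set_lebesgue_integral_def using int by simp
    also have "\<dots> \<le> (LINT x|\<nu>. 2 * (\<theta>' (g x) * f x))"
    proof (rule integral_mono_AE)
      show "AE x in \<nu>. (indicator {x. g x \<le> r + e} x * \<phi> x - indicator {x. g x \<le> r} x * \<phi> x) / e \<le> 2 * (\<theta>' (g x) * f x)"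
        using f(2)
      proof eventually_elim
        fix x assume le: "\<phi> x \<le> f x"
        show "(indicator {x. g x \<le> r + e} x * \<phi> x - indicator {x. g x \<le> r} x * \<phi> x) / e \<le> 2 * (\<theta>' (g x) * f x)"
        proof (cases "r < g x \<and> g x \<le> r + e")
          case True
          then have "\<bar>(g x - r) / e\<bar> \<le> 1"
            using e by simp
          then have "1 / 2 / e \<le> \<theta>' (g x)"
            unfolding \<theta>'_def using e by (intro divide_right_mono k_half) auto
          then have "(1 / 2 / e) * \<phi> x \<le> \<theta>' (g x) * f x"
            using le \<phi>(2)[of x] nn by (intro mult_mono) auto
          then show ?thesis
            using True by simp
        next
          case False
          have "0 \<le> 2 * (\<theta>' (g x) * f x)"
            using nn le \<phi>(2)[of x] by simp
          then show ?thesis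
            using False e by (auto simp: indicator_def)
        qed
      qed
    qed (use int int\<theta>(1) in simp_all)
    also have "\<dots> = 2 * (LINT x|\<nu>. \<theta>' (g x) * f x)"
      by simp
    also have "\<dots> \<le> ?B"
      using int\<theta>(2) by simp
    finally show ?thesis .
  qed
  have "(\<Gamma> has_real_derivative (LINT x|\<sigma>. \<phi> x)) (at r)"
    using \<sigma> \<phi> unfolding is_level_measure_def \<Gamma>_def by blast
  then have "((\<lambda>e. (\<Gamma> (r + e) - \<Gamma> r) / e) \<longlongrightarrow> (LINT x|\<sigma>. \<phi> x)) (at 0)"
    by (simp add: DERIV_def)
  then have "((\<lambda>e. (\<Gamma> (r + e) - \<Gamma> r) / e) \<longlongrightarrow> (LINT x|\<sigma>. \<phi> x)) (at_right 0)"
    by (rule tendsto_mono[rotated]) (simp add: at_le)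
  then show ?thesis
    by (rule tendsto_upperbound) (auto intro: eventually_mono[OF eventually_at_right_less] quotient)
qed

lemma level_measure_open_bound:
  assumes \<sigma>: "is_level_measure \<nu> g r \<sigma>" and U: "open U"
    and f: "M_graph \<nu> R p f F" "AE x in \<nu>. indicator U x \<le> f x"
  shows "measure \<sigma> U \<le> pi * ((lp_norm \<nu> (p / (p - 1)) h + lp_norm \<nu> (p / (p - 1)) \<Psi>) *
      (lp_norm \<nu> p f + lp_norm \<nu> p F))" (is "_ \<le> ?B")
proof -
  interpret \<sigma>: finite_measure \<sigma>
    using \<sigma> by (simp add: is_level_measure_def)
  have sets_\<sigma>: "sets \<sigma> = sets borel"
    using \<sigma> by (simp add: is_level_measure_def)
  have [measurable]: "U \<in> sets \<sigma>"
    using U by (simp add: sets_\<sigma>)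
  obtain u where u: "\<And>n::nat. u n \<in> Cb" "\<And>n x. 0 \<le> u n x" "\<And>n x. u n x \<le> indicator U x"
    "\<And>x. (\<lambda>n. u n x) \<longlonglongrightarrow> indicator U x"
    using open_indicator_limit_Cb[OF U] by blast
  have [measurable]: "u n \<in> borel_measurable \<sigma>" for n
    unfolding measurable_cong_sets[OF sets_\<sigma> refl]
    using u(1) by (auto simp: Cb_def intro: borel_measurable_continuous_onI)
  have "(\<lambda>n. LINT x|\<sigma>. u n x) \<longlonglongrightarrow> (LINT x|\<sigma>. indicator U x)"
  proof (rule integral_dominated_convergence[where w="\<lambda>_. 1"])
    show "AE x in \<sigma>. norm (u n x) \<le> 1" for n
      using u(2,3)[of n] by (auto intro!: AE_I2 order_trans[OF u(3)] simp: indicator_def)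
  qed (use u(4) in auto)
  moreover have "(LINT x|\<sigma>. u n x) \<le> ?B" for n
    using f(2) by (intro level_measure_Cb_bound[OF \<sigma> u(1,2) f(1)]) (auto intro: order_trans[OF u(3)])
  ultimately have "(LINT x|\<sigma>. indicator U x) \<le> ?B"
    by (auto intro: LIMSEQ_le_const2)
  then show ?thesis
    using sets_eq_imp_space_eq[OF sets_\<sigma>] by simp
qed

lemma level_measure_le_capacity:
  assumes \<sigma>: "is_level_measure \<nu> g r \<sigma>" and B: "B \<in> sets borel"
  shows "measure \<sigma> B \<le> pi * (lp_norm \<nu> (p / (p - 1)) h + lp_norm \<nu> (p / (p - 1)) \<Psi>) * capacity \<nu> R p B"
    (is "_ \<le> ?C * _")
proof -
  interpret \<sigma>: finite_measure \<sigma>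
    using \<sigma> by (simp add: is_level_measure_def)
  have sets_\<sigma>: "sets \<sigma> = sets borel"
    using \<sigma> by (simp add: is_level_measure_def)
  have C: "0 \<le> ?C"
    by (simp add: lp_norm_nonneg)
  have le: "measure \<sigma> B \<le> ?C * (capacity \<nu> R p B + inverse (real (Suc n)))" for n
  proof -
    have "capacity \<nu> R p B < capacity \<nu> R p B + inverse (real (Suc n))"
      by simp
    then obtain U f where U: "open U" "B \<subseteq> U" and f: "f \<in> W1p \<nu> R p" "AE x in \<nu>. indicator U x \<le> f x"
      "W1p_norm \<nu> R p f < capacity \<nu> R p B + inverse (real (Suc n))"
      by (rule W1p_norm_test_function)
    have "measure \<sigma> B \<le> measure \<sigma> U"
      using U B by (intro \<sigma>.finite_measure_mono) (auto simp: sets_\<sigma>)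
    also have "\<dots> \<le> ?C * W1p_norm \<nu> R p f"
      using level_measure_open_bound[OF \<sigma> U(1) M_graph_M_op[OF f(1)] f(2)]
      by (simp add: W1p_norm_def mult.assoc)
    also have "\<dots> \<le> ?C * (capacity \<nu> R p B + inverse (real (Suc n)))"
      using f(3) C by (intro mult_left_mono) auto
    finally show ?thesis .
  qed
  have "(\<lambda>n. ?C * (capacity \<nu> R p B + inverse (real (Suc n)))) \<longlonglongrightarrow> ?C * (capacity \<nu> R p B + 0)"
    by (intro tendsto_intros LIMSEQ_inverse_real_of_nat)
  from LIMSEQ_le_const[OF this] le show ?thesis by auto
qed

end

theorem proposition4p3:
  fixes \<nu> :: "'a::{real_inner, complete_space, second_countable_topology} measure"
    and R :: "'a \<Rightarrow> 'a"
    and g :: "'a \<Rightarrow> real"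
    and B :: "'a set"
  assumes infinite_dim: "\<not> (\<exists>S::'a set. finite S \<and> span S = UNIV)"
    and nu_borel: "sets \<nu> = sets borel"
    and nu_prob: "prob_space \<nu>"
    and nu_nondegenerate: "nondegenerate \<nu>"
    and R_bounded_linear: "bounded_linear R"
    and closable: "\<And>p::real. 1 < p \<Longrightarrow> closable_R_grad \<nu> R p"
    and g_borel: "g \<in> borel_measurable borel"
    and g_W1p: "\<And>p::real. 1 < p \<Longrightarrow> g \<in> W1p \<nu> R p"
    and Mg_nonzero: "\<And>p::real. 1 < p \<Longrightarrow> AE x in \<nu>. M_op \<nu> R p g x \<noteq> 0"
    and Mg_adj: "\<And>p::real. 1 < p \<Longrightarrow>
      (\<lambda>x. M_op \<nu> R p g x /\<^sub>R (norm (M_op \<nu> R p g x))\<^sup>2) \<in> M_adj_dom \<nu> R p"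
    and B_borel: "B \<in> sets borel"
    and B_capacity: "\<exists>p::real. 1 < p \<and> capacity \<nu> R p B = 0"
  shows "\<forall>r \<sigma>. is_level_measure \<nu> g r \<sigma> \<longrightarrow> emeasure \<sigma> B = 0"
proof (intro allI impI)
  fix r \<sigma> assume \<sigma>: "is_level_measure \<nu> g r \<sigma>"
  obtain p where p: "1 < p" "capacity \<nu> R p B = 0"
    using B_capacity by blast
  interpret prob_space \<nu> by (rule nu_prob)
  interpret R_gradient \<nu> R p
    by (intro R_gradient.intro R_gradient_axioms.intro finite_measure_axioms nu_borel
        R_bounded_linear p(1) closable)
  let ?G = "M_op \<nu> R p g"
  let ?\<Psi> = "\<lambda>x. ?G x /\<^sub>R (norm (?G x))\<^sup>2"
  obtain h where h: "M_adj_graph \<nu> R p ?\<Psi> h"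
    using Mg_adj[OF p(1)] by (auto simp: M_adj_dom_def)
  have "AE x in \<nu>. ?G x \<bullet> ?\<Psi> x = 1"
    using Mg_nonzero[OF p(1)] by eventually_elim (simp add: power2_norm_eq_inner)
  then interpret transversal_field \<nu> R p g ?G ?\<Psi> h
    by (intro transversal_field.intro transversal_field_axioms.intro R_gradient_axioms
        M_graph_M_op g_W1p p(1) h)
  have "measure \<sigma> B \<le> 0"
    using level_measure_le_capacity[OF \<sigma> B_borel] p(2) by simp
  moreover have "finite_measure \<sigma>"
    using \<sigma> by (simp add: is_level_measure_def)
  ultimately show "emeasure \<sigma> B = 0"
    by (simp add: finite_measure.emeasure_eq_measure measure_le_0_iff)
qed

end
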